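(* If $f(z)=z+a_2z^2+\cdots\in\mathcal{S}^*$, then $$\operatorname{Re}\sqrt{\frac{f(z)}{z}}>\alpha\qquad\text{for all }z\in\mathbb{D},$$ where $$\alpha=\frac{20+|a_2|-\sqrt{16+|a_2|^2+40|a_2|}}{24}.$$
   Context: $\mathbb{D}=\{z\in\mathbb{C}:|z|<1\}$. $\mathcal{A}$ is the class of analytic functions $f$ in $\mathbb{D}$ of the form $f(z)=z+a_2z^2+a_3z^3+\cdots$. $\mathcal{S}^*$ (starlike functions) is the class of $f\in\mathcal{A}$ with $\operatorname{Re}\left(\frac{zf'(z)}{f(z)}\right)>0$ for all $z\in\mathbb{D}$. For such $f$ the function $f(z)/z$ (with value $1$ at $z=0$) has no zeros in $\mathbb{D}$, and $\sqrt{f(z)/z}$ denotes its analytic square root in $\mathbb{D}$ taking the value $1$ at $z=0$. *)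

theory Defs
  imports "HOL-Complex_Analysis.Complex_Analysis"
begin

definition class_A :: "(complex \<Rightarrow> complex) set" where
  "class_A = {f. f holomorphic_on ball 0 1 \<and> f 0 = 0 \<and> deriv f 0 = 1}"

definition taylor_coeff :: "(complex \<Rightarrow> complex) \<Rightarrow> nat \<Rightarrow> complex" where
  "taylor_coeff f n = fps_nth (fps_expansion f 0) n"

(* The point 0 is left out of the quantifier because z * f'(z) / f(z) has a removable
   singularity there, with value 1, whereas HOL's 0 / 0 = 0 would make the condition false.
   At any other zero of f the quotient is 0 in HOL, so the condition fails there. *)
definition class_S_star :: "(complex \<Rightarrow> complex) set" where
  "class_S_star = {f \<in> class_A. \<forall>z \<in> ball 0 1 - {0}. Re (z * deriv f z / f z) > 0}"

definition quot_z :: "(complex \<Rightarrow> complex) \<Rightarrow> complex \<Rightarrow> complex" where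
  "quot_z f z = (if z = 0 then 1 else f z / z)"

definition is_sqrt_quot_z :: "(complex \<Rightarrow> complex) \<Rightarrow> (complex \<Rightarrow> complex) \<Rightarrow> bool" where
  "is_sqrt_quot_z f g \<longleftrightarrow>
     g holomorphic_on ball 0 1 \<and> g 0 = 1 \<and> (\<forall>z \<in> ball 0 1. (g z)\<^sup>2 = quot_z f z)"

(* For f in class_S_star such a g exists and is unique on the disc (the two lemmas below).
   It is not csqrt of f(z) / z, which need not be continuous on the disc a priori. *)
definition sqrt_quot_z :: "(complex \<Rightarrow> complex) \<Rightarrow> complex \<Rightarrow> complex" where
  "sqrt_quot_z f = (SOME g. is_sqrt_quot_z f g)"

lemma quot_z_holomorphic:
  assumes "f \<in> class_A"
  shows "quot_z f holomorphic_on ball 0 1"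
proof -
  have "(\<lambda>z. if z = 0 then deriv f 0 else (f z - f 0) / (z - 0)) holomorphic_on ball 0 1"
    by (rule pole_lemma_open) (use assms in \<open>auto simp: class_A_def\<close>)
  moreover have "(\<lambda>z. if z = 0 then deriv f 0 else (f z - f 0) / (z - 0)) = quot_z f"
    using assms by (auto simp: class_A_def quot_z_def)
  ultimately show ?thesis by simp
qed

lemma quot_z_nonzero:
  assumes "f \<in> class_S_star" "z \<in> ball 0 1"
  shows "quot_z f z \<noteq> 0"
proof (cases "z = 0")
  case False
  with assms have "Re (z * deriv f z / f z) > 0"
    by (auto simp: class_S_star_def)
  hence "f z \<noteq> 0" by auto
  with False show ?thesis by (simp add: quot_z_def)
qed (simp add: quot_z_def)

lemma is_sqrt_quot_z_exists:
  assumes "f \<in> class_S_star"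
  shows "\<exists>g. is_sqrt_quot_z f g"
proof -
  have "f \<in> class_A" using assms by (simp add: class_S_star_def)
  obtain g where g: "g holomorphic_on ball 0 1"
      "\<And>z. z \<in> ball 0 1 \<Longrightarrow> quot_z f z = (g z)\<^sup>2"
    using contractible_imp_holomorphic_sqrt[OF quot_z_holomorphic[OF \<open>f \<in> class_A\<close>]
        convex_imp_contractible[OF convex_ball] quot_z_nonzero[OF assms]] by metis
  have g0: "(g 0)\<^sup>2 = 1" using g(2)[of 0] by (simp add: quot_z_def)
  have "(\<lambda>z. g 0 * g z) holomorphic_on ball 0 1"
    using g(1) by (intro holomorphic_intros)
  hence "is_sqrt_quot_z f (\<lambda>z. g 0 * g z)"
    using g(2) g0 by (simp add: is_sqrt_quot_z_def power_mult_distrib flip: power2_eq_square)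
  thus ?thesis by blast
qed

lemma is_sqrt_quot_z_unique:
  assumes f: "f \<in> class_S_star" and g: "is_sqrt_quot_z f g" and h: "is_sqrt_quot_z f h"
    and z: "z \<in> ball 0 1"
  shows "g z = h z"
proof -
  have ne: "h w \<noteq> 0" if "w \<in> ball 0 1" for w
    using h quot_z_nonzero[OF f that] that unfolding is_sqrt_quot_z_def
    by (metis zero_power2)
  have "continuous_on (ball 0 1) (\<lambda>w. g w / h w)"
    using g h ne by (intro continuous_intros)
      (auto simp: is_sqrt_quot_z_def intro: holomorphic_on_imp_continuous_on)
  moreover have sq: "g w / h w \<in> {1, -1}" if "w \<in> ball 0 1" for w
  proof -
    have "(g w)\<^sup>2 = (h w)\<^sup>2" using g h that by (simp add: is_sqrt_quot_z_def)
    thus ?thesis using ne[OF that] by (auto simp: power2_eq_iff)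
  qed
  have "finite ((\<lambda>w. g w / h w) ` ball 0 1)"
    by (rule finite_subset[of _ "{1, -1}"]) (use sq in blast)+
  ultimately have "(\<lambda>w. g w / h w) constant_on ball 0 1"
    by (intro continuous_finite_range_constant) auto
  hence "g z / h z = g 0 / h 0"
    using z unfolding constant_on_def by (metis centre_in_ball zero_less_one)
  thus ?thesis using g h ne[OF z] by (simp add: is_sqrt_quot_z_def)
qed

end

theory Submission
  imports Defs
begin

text \<open>
  Let \<open>g\<close> be the square root of \<open>f(z)/z\<close>, so that \<open>z f'/f = 1 + 2 z g'/g\<close>. If \<open>Re g \<le> \<alpha>\<close> somewhere,
  take such a point \<open>z0\<close> of least modulus. The Cayley transform of the half-plane \<open>Re > \<alpha>\<close> turns
  \<open>\<zeta> \<mapsto> g (z0 \<zeta>)\<close> into a self-map \<open>w\<close> of the disc fixing 0 and reaching the circle at 1, where the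
  boundary Schwarz lemma with fixed \<open>c = |w'(0)|\<close> bounds the radial derivative below by
  \<open>2 / (1 + c)\<close>. Moreover \<open>z0 g'(z0)\<close> is real because \<open>Re g\<close> is minimal at \<open>z0\<close> on the circle through
  \<open>z0\<close>. Together these give \<open>Re (z f'/f) \<le> 0\<close> at \<open>z0\<close>, since \<open>\<alpha> \<ge> 1/2\<close> solves
  \<open>8 (1 - \<alpha>)^2 = \<alpha> (4 (1 - \<alpha>) + |a2|)\<close>. That \<open>\<alpha> \<ge> 1/2\<close> is equivalent to \<open>|a2| \<le> 2\<close>.
\<close>

section \<open>Schwarz estimates with prescribed derivative at 0, in the disc and at the
  boundary\<close>

text \<open>The last hypothesis is a Schwarz-Pick inequality for a value of modulus \<open>x\<close>
  against one of modulus \<open>c\<close>, squared and expanded. Replacing \<open>R\<close> by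
  \<open>c * x\<close> makes the difference of its sides factor as
  \<open>(x * (1 + c * r) - (r + c)) * (x * (1 - c * r) - (c - r))\<close>, and the second factor is
  positive whenever the first is.\<close>

lemma disc_bound_algebra:
  fixes x c r R :: real
  assumes "0 \<le> r" "r < 1" "0 \<le> c" "c < 1" "R \<le> c * x"
    and "x\<^sup>2 - 2 * R + c\<^sup>2 \<le> r\<^sup>2 * (1 - 2 * R + c\<^sup>2 * x\<^sup>2)"
  shows "x * (1 + c * r) \<le> r + c"
proof (rule ccontr)
  assume "\<not> ?thesis"
  hence 1: "x * (1 + c * r) - (r + c) > 0" by simp
  have cr: "c * r < 1" "0 \<le> c * r"
    using assms mult_strict_mono'[of c 1 r 1] by auto
  have "0 \<le> 2 * r * (1 - c\<^sup>2)" using assms by (simp add: power_le_one)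
  also have "\<dots> = (r + c) * (1 - c * r) - (c - r) * (1 + c * r)"
    by (simp add: algebra_simps power2_eq_square)
  also have "\<dots> < x * (1 + c * r) * (1 - c * r) - (c - r) * (1 + c * r)"
    using 1 cr by simp
  also have "\<dots> = (x * (1 - c * r) - (c - r)) * (1 + c * r)"
    by (simp add: algebra_simps)
  finally have "x * (1 - c * r) - (c - r) > 0"
    using cr by (simp add: zero_less_mult_iff)
  with 1 have "0 < (x * (1 + c * r) - (r + c)) * (x * (1 - c * r) - (c - r))"
    by simp
  also have "\<dots> = x\<^sup>2 + c\<^sup>2 - r\<^sup>2 - r\<^sup>2 * c\<^sup>2 * x\<^sup>2 - 2 * (c * x) * (1 - r\<^sup>2)"
    by (simp add: algebra_simps power2_eq_square)
  also have "\<dots> \<le> x\<^sup>2 + c\<^sup>2 - r\<^sup>2 - r\<^sup>2 * c\<^sup>2 * x\<^sup>2 - 2 * R * (1 - r\<^sup>2)"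
    using assms by (intro diff_left_mono mult_right_mono) (auto simp: power_le_one)
  also have "\<dots> \<le> 0" using assms(6) by (simp add: algebra_simps)
  finally show False by simp
qed

text \<open>Write \<open>w z = z * h z\<close> with \<open>h 0 = deriv w 0\<close>. Unless
  \<open>w\<close> is a rotation, \<open>h\<close> maps the disc into itself, and Schwarz-Pick for
  \<open>h\<close> between 0 and \<open>z\<close> bounds \<open>cmod (h z)\<close>.\<close>

lemma Schwarz_growth:
  assumes holw: "w holomorphic_on ball 0 1" and w0: "w 0 = 0"
    and w1: "\<And>z. cmod z < 1 \<Longrightarrow> cmod (w z) < 1" and z: "cmod z < 1"
  shows "cmod (w z) * (1 + cmod (deriv w 0) * cmod z) \<le> cmod z * (cmod z + cmod (deriv w 0))"
proof -
  obtain h where holh: "h holomorphic_on ball 0 1"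
    and h: "\<And>z. cmod z < 1 \<Longrightarrow> w z = z * h z" and h0: "deriv w 0 = h 0"
    using Schwarz3[OF holw w0] by metis
  note Sch = Schwarz_Lemma[OF holw w0 w1]
  show ?thesis
  \<comment> \<open>For a rotation equality holds; it is split off because the Moebius argument
    needs \<open>cmod (h u) < 1\<close> strictly.\<close>
  proof (cases "\<exists>\<alpha>. (\<forall>z. cmod z < 1 \<longrightarrow> w z = \<alpha> * z) \<and> cmod \<alpha> = 1")
    case True
    then obtain \<alpha> where \<alpha>: "\<And>z. cmod z < 1 \<Longrightarrow> w z = \<alpha> * z" "cmod \<alpha> = 1" by blast
    have "(w has_field_derivative \<alpha>) (at 0)"
      by (rule has_field_derivative_transform_within_open[of "\<lambda>z. \<alpha> * z" _ _ "ball 0 1"])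
        (auto intro!: derivative_eq_intros simp: \<alpha>)
    hence "deriv w 0 = \<alpha>" by (rule DERIV_imp_deriv)
    with \<alpha> z show ?thesis by (simp add: norm_mult algebra_simps)
  next
    case False
    have h1: "cmod (h u) < 1" if u: "cmod u < 1" for u
    proof (cases "u = 0")
      case True
      with Sch(2,3)[of 0] False h0 show ?thesis by fastforce
    next
      case nz: False
      have "cmod (w u) \<le> cmod u" "cmod (w u) \<noteq> cmod u"
        using Sch(1,3)[of u] u nz False by auto
      with nz h[OF u] show ?thesis by (simp add: norm_mult)
    qed
    \<comment> \<open>Moving \<open>h 0\<close> to the origin lets the Schwarz lemma apply to
      \<open>F\<close>; \<open>cmod (F z) \<le> cmod z\<close> is the Schwarz-Pick inequality for
      \<open>h\<close>.\<close>
    define F where "F = (\<lambda>u. Moebius_function 0 (h 0) (h u))"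
    have "F holomorphic_on ball 0 1"
      unfolding F_def using h1
      by (intro holomorphic_on_compose_gen[OF holh Moebius_function_holomorphic, unfolded o_def]) auto
    moreover have "F 0 = 0" by (simp add: F_def Moebius_function_eq_zero)
    moreover have "\<And>u. cmod u < 1 \<Longrightarrow> cmod (F u) < 1"
      using h1 by (simp add: F_def Moebius_function_norm_lt_1)
    ultimately have Fz: "cmod (F z) \<le> cmod z"
      using Schwarz_Lemma(1) z by blast
    have "cmod (cnj (h 0) * h z) < 1"
      using mult_strict_mono'[of "cmod (h 0)" 1 "cmod (h z)" 1] h1 z by (simp add: norm_mult)
    hence "1 - cnj (h 0) * h z \<noteq> 0" by auto
    with Fz have "cmod (h z - h 0) \<le> cmod z * cmod (1 - cnj (h 0) * h z)"
      by (simp add: F_def Moebius_function_simple norm_divide pos_divide_le_eq)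
    hence "(cmod (h z - h 0))\<^sup>2 \<le> (cmod z)\<^sup>2 * (cmod (1 - cnj (h 0) * h z))\<^sup>2"
      by (metis norm_ge_zero power_mono power_mult_distrib)
    moreover have "(cmod (h z - h 0))\<^sup>2 = (cmod (h z))\<^sup>2 - 2 * Re (cnj (h 0) * h z) + (cmod (h 0))\<^sup>2"
      unfolding cmod_power2 by (simp add: algebra_simps power2_eq_square)
    moreover have "(cmod (1 - cnj (h 0) * h z))\<^sup>2
        = 1 - 2 * Re (cnj (h 0) * h z) + (cmod (h 0))\<^sup>2 * (cmod (h z))\<^sup>2"
      unfolding cmod_power2 by (simp add: algebra_simps power2_eq_square)
    moreover have "Re (cnj (h 0) * h z) \<le> cmod (h 0) * cmod (h z)"
      by (metis complex_Re_le_cmod norm_mult complex_mod_cnj)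
    ultimately have "cmod (h z) * (1 + cmod (h 0) * cmod z) \<le> cmod z + cmod (h 0)"
      by (intro disc_bound_algebra[where R = "Re (cnj (h 0) * h z)"]) (use h1 z in auto)
    hence "cmod z * (cmod (h z) * (1 + cmod (h 0) * cmod z)) \<le> cmod z * (cmod z + cmod (h 0))"
      by (rule mult_left_mono) simp
    thus ?thesis by (simp add: h[OF z] h0 norm_mult mult_ac)
  qed
qed

text \<open>Along the radius to 1 the growth estimate gives
  \<open>Re (cnj (w 1) * w t) \<le> t * (t + c) / (1 + c * t)\<close>. Both sides equal 1 at
  \<open>t = 1\<close>, so the left side must arrive there with at least the slope
  \<open>2 / (1 + c)\<close> of the right side.\<close>

lemma boundary_Schwarz:
  assumes holw: "w holomorphic_on ball 0 1" and w0: "w 0 = 0"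
    and w1: "\<And>z. cmod z < 1 \<Longrightarrow> cmod (w z) < 1"
    and "cmod (w 1) = 1" and D: "(w has_field_derivative D) (at 1)"
  shows "Re (cnj (w 1) * D) \<ge> 2 / (1 + cmod (deriv w 0))"
proof (rule ccontr)
  assume neg: "\<not> ?thesis"
  define c where "c = cmod (deriv w 0)"
  have c: "c \<ge> 0" by (simp add: c_def)
  \<comment> \<open>\<open>\<phi>\<close> vanishes at 1 and is nonpositive on (0, 1); a negative
    derivative at 1 would make it positive just to the left.\<close>
  define \<phi> where "\<phi> = (\<lambda>t::real. Re (cnj (w 1) * w (of_real t)) - t * (t + c) / (1 + c * t))"
  have "((\<lambda>t::real. Re (cnj (w 1) * w (of_real t))) has_field_derivative Re (cnj (w 1) * D)) (at 1)"
  proof -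
    have "(w has_field_derivative D) (at (of_real 1))" using D by simp
    from has_vector_derivative_real_field[OF this]
    have "((\<lambda>t. w (of_real t)) has_vector_derivative D) (at 1)" by simp
    hence "((\<lambda>t. cnj (w 1) * w (of_real t)) has_vector_derivative cnj (w 1) * D) (at 1)"
      by (rule has_vector_derivative_mult_right)
    thus ?thesis
      unfolding has_vector_derivative_complex_iff by (simp add: o_def)
  qed
  moreover have "((\<lambda>t. t * (t + c) / (1 + c * t)) has_field_derivative 2 / (1 + c)) (at 1)"
    using c by (auto intro!: derivative_eq_intros simp: divide_simps add_nonneg_eq_0_iff)
      (simp_all add: algebra_simps)
  ultimately have "(\<phi> has_field_derivative Re (cnj (w 1) * D) - 2 / (1 + c)) (at 1)"
    unfolding \<phi>_def by (rule DERIV_diff)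
  moreover have "Re (cnj (w 1) * D) - 2 / (1 + c) < 0" using neg by (simp add: c_def)
  ultimately obtain d where d: "d > 0" "\<And>h. 0 < h \<Longrightarrow> h < d \<Longrightarrow> \<phi> 1 < \<phi> (1 - h)"
    using DERIV_neg_dec_left by blast
  define t where "t = 1 - min (d/2) (1/2)"
  have t: "0 < t" "t < 1" using d(1) by (auto simp: t_def min_def)
  have "\<phi> 1 < \<phi> t" unfolding t_def using d by (intro d(2)) auto
  moreover have "\<phi> 1 = 0"
  proof -
    have "cnj (w 1) * w 1 = 1"
      using \<open>cmod (w 1) = 1\<close> by (simp add: mult.commute flip: complex_norm_square)
    thus ?thesis unfolding \<phi>_def of_real_1 using c by (simp only:) (simp add: add.commute)
  qed
  moreover have "\<phi> t \<le> 0"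
  proof -
    have "cmod (w (of_real t)) * (1 + c * t) \<le> t * (t + c)"
      using Schwarz_growth[OF holw w0 w1, of "of_real t"] t by (simp add: c_def)
    moreover have "1 + c * t > 0" using c t by (simp add: add_pos_nonneg)
    ultimately have "cmod (w (of_real t)) \<le> t * (t + c) / (1 + c * t)"
      by (simp add: pos_le_divide_eq)
    moreover have "Re (cnj (w 1) * w (of_real t)) \<le> cmod (w (of_real t))"
      using complex_Re_le_cmod[of "cnj (w 1) * w (of_real t)"] assms(4) by (simp add: norm_mult)
    ultimately show ?thesis by (simp add: \<phi>_def)
  qed
  ultimately show False by simp
qed

section \<open>Transfer to the half-plane \<open>Re > \<alpha>\<close>\<close>

text \<open>The boundary Schwarz lemma is applied to the Cayley transform of \<open>q\<close>. The
  radius \<open>R > 1\<close> provides differentiability at the boundary point 1.\<close>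

lemma half_plane_boundary_deriv:
  assumes R: "R > 1" and holq: "q holomorphic_on ball 0 R" and q0: "q 0 = 1" and \<alpha>: "\<alpha> < 1"
    and Req: "\<And>z. cmod z < 1 \<Longrightarrow> Re (q z) > \<alpha>" and q1: "Re (q 1) = \<alpha>"
  shows "Im (deriv q 1) = 0"
    and "Re (deriv q 1) \<le>
      - ((1 - \<alpha>)\<^sup>2 + (Im (q 1))\<^sup>2) / ((1 - \<alpha>) * (1 + cmod (deriv q 0) / (2 * (1 - \<alpha>))))"
proof -
  define D where "D = deriv q 1"
  have D: "(q has_field_derivative D) (at 1)"
    unfolding D_def using R by (intro holomorphic_derivI[OF holq]) auto
  have q_ge: "Re (q z) \<ge> \<alpha>" if "cmod z \<le> 1" for z
  proof -
    have "continuous_on (closure (ball 0 1)) (\<lambda>z. Re (q z))"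
      using R by (intro continuous_intros holomorphic_on_imp_continuous_on
          holomorphic_on_subset[OF holq]) auto
    from continuous_ge_on_closure[OF this, of z \<alpha>] show ?thesis
      using that Req by force
  qed
  \<comment> \<open>On the unit circle \<open>Re q\<close> is minimal at 1, so its tangential
    derivative vanishes there, which makes \<open>D\<close> real.\<close>
  have "((\<lambda>t::real. Re (q (exp (\<i> * of_real t)))) has_field_derivative Re (D * \<i>)) (at 0)"
  proof -
    have "((\<lambda>z. q (exp (\<i> * z))) has_field_derivative D * \<i>) (at (of_real 0))"
      by (rule DERIV_chain2[where g = "\<lambda>z. exp (\<i> * z)"]) (auto intro!: derivative_eq_intros simp: D)
    from has_vector_derivative_real_field[OF this] show ?thesis
      unfolding has_vector_derivative_complex_iff by (simp add: o_def)
  qed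
  hence "Re (D * \<i>) = 0"
    by (rule DERIV_local_min[where d = 1]) (auto simp: q1 intro!: q_ge)
  thus Im0: "Im (deriv q 1) = 0" by (simp add: D_def)
  define \<beta> where "\<beta> = 1 - \<alpha>"
  have \<beta>: "\<beta> > 0" using \<alpha> by (simp add: \<beta>_def)
  \<comment> \<open>The pole \<open>1 - 2 * \<beta> = 2 * \<alpha> - 1\<close> is the mirror image
    of \<open>q 0 = 1\<close> in the line \<open>Re = \<alpha>\<close>.\<close>
  define w where "w = (\<lambda>z. (q z - 1) / (q z + of_real (2 * \<beta> - 1)))"
  have nz: "q z + of_real (2 * \<beta> - 1) \<noteq> 0" if "cmod z \<le> 1" for z
  proof
    assume "q z + of_real (2 * \<beta> - 1) = 0"
    hence "Re (q z + of_real (2 * \<beta> - 1)) = 0" by (simp only: zero_complex.sel)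
    with q_ge[OF that] \<beta> show False by (simp add: \<beta>_def)
  qed
  have holw: "w holomorphic_on ball 0 1"
    unfolding w_def using R nz
    by (intro holomorphic_intros holomorphic_on_subset[OF holq]) auto
  have w0: "w 0 = 0" by (simp add: w_def q0)
  \<comment> \<open>This identity gives both \<open>cmod (w z) < 1\<close> inside the disc and
    \<open>cmod (w 1) = 1\<close>.\<close>
  have w_sq: "(cmod (q z + of_real (2 * \<beta> - 1)))\<^sup>2 - (cmod (q z - 1))\<^sup>2 = 4 * \<beta> * (Re (q z) - \<alpha>)" for z
    unfolding cmod_power2 by (simp add: \<beta>_def power2_eq_square algebra_simps)
  have w1: "cmod (w z) < 1" if z: "cmod z < 1" for z
  proof -
    have "0 < 4 * \<beta> * (Re (q z) - \<alpha>)" using \<beta> Req[OF z] by simp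
    hence "(cmod (q z - 1))\<^sup>2 < (cmod (q z + of_real (2 * \<beta> - 1)))\<^sup>2" using w_sq[of z] by simp
    hence "cmod (q z - 1) < cmod (q z + of_real (2 * \<beta> - 1))"
      by (rule power_less_imp_less_base) simp
    with nz[of z] z show ?thesis by (simp add: w_def norm_divide)
  qed
  have "(cmod (q 1 - 1))\<^sup>2 = (cmod (q 1 + of_real (2 * \<beta> - 1)))\<^sup>2" using w_sq[of 1] q1 by simp
  hence "cmod (q 1 - 1) = cmod (q 1 + of_real (2 * \<beta> - 1))" by (simp add: power2_eq_iff_nonneg)
  hence mw1: "cmod (w 1) = 1" using nz[of 1] by (simp add: w_def norm_divide)
  have w_deriv: "(w has_field_derivative of_real (2 * \<beta>) * E / (q z + of_real (2 * \<beta> - 1))\<^sup>2) (at z)"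
    if "(q has_field_derivative E) (at z)" "cmod z \<le> 1" for E z
    unfolding w_def using nz[OF that(2)]
    by (auto intro!: derivative_eq_intros that(1) simp: power2_eq_square field_simps)
  have "(q has_field_derivative deriv q 0) (at 0)"
    using R by (intro holomorphic_derivI[OF holq]) auto
  from w_deriv[OF this] have "deriv w 0 = of_real (2 * \<beta>) * deriv q 0 / (of_real (2 * \<beta>))\<^sup>2"
    by (intro DERIV_imp_deriv) (simp add: q0)
  hence dw0: "cmod (deriv w 0) = cmod (deriv q 0) / (2 * \<beta>)"
    using \<beta> by (simp add: norm_mult norm_divide power2_eq_square)
  define c where "c = cmod (deriv q 0) / (2 * \<beta>)"
  have c: "c \<ge> 0" using \<beta> by (simp add: c_def)
  define N where "N = \<beta>\<^sup>2 + (Im (q 1))\<^sup>2"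
  have N: "N > 0" using \<beta> by (simp add: N_def add_pos_nonneg)
  have "cnj (w 1) * w 1 = 1"
    using mw1 by (simp add: mult.commute flip: complex_norm_square)
  \<comment> \<open>Dividing by \<open>w 1\<close> cancels one factor of the squared denominator.
    The remaining product is the negative real \<open>- N\<close>, since its factors are
    \<open>- \<beta> + \<i> * Im (q 1)\<close> and \<open>\<beta> + \<i> * Im (q 1)\<close>.\<close>
  hence "cnj (w 1) = 1 / w 1" by (metis mult_zero_right nonzero_eq_divide_eq zero_neq_one)
  hence "cnj (w 1) * (of_real (2 * \<beta>) * D / (q 1 + of_real (2 * \<beta> - 1))\<^sup>2)
       = of_real (2 * \<beta>) * D / ((q 1 - 1) * (q 1 + of_real (2 * \<beta> - 1)))"
    using nz[of 1] by (simp add: w_def power2_eq_square)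
  also have "(q 1 - 1) * (q 1 + of_real (2 * \<beta> - 1)) = - of_real N"
    by (simp add: complex_eq_iff N_def \<beta>_def q1 power2_eq_square algebra_simps)
  also have "of_real (2 * \<beta>) * D / - of_real N = of_real (- (2 * \<beta> * Re D / N))"
    using Im0 by (simp add: complex_eq_iff D_def)
  finally have "2 / (1 + c) \<le> - (2 * \<beta> * Re D / N)"
    using boundary_Schwarz[OF holw w0 w1 mw1 w_deriv[OF D]] by (simp add: dw0 c_def)
  hence "Re D * (\<beta> * (1 + c)) \<le> - N"
    using N c by (simp add: field_simps)
  hence "Re D \<le> - N / (\<beta> * (1 + c))"
    using \<beta> c by (subst pos_le_divide_eq) auto
  thus "Re (deriv q 1) \<le>
      - ((1 - \<alpha>)\<^sup>2 + (Im (q 1))\<^sup>2) / ((1 - \<alpha>) * (1 + cmod (deriv q 0) / (2 * (1 - \<alpha>))))"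
    by (simp add: D_def N_def c_def \<beta>_def)
qed

section \<open>Starlikeness expressed through the square root \<open>g\<close>\<close>

lemma starlike_sqrt_log_deriv:
  assumes f: "f \<in> class_S_star" and g: "is_sqrt_quot_z f g" and z: "cmod z < 1"
  shows "g z \<noteq> 0" and "Re (z * deriv g z / g z) > - 1 / 2"
proof -
  show gz: "g z \<noteq> 0"
    using g quot_z_nonzero[OF f, of z] z unfolding is_sqrt_quot_z_def
    by (metis mem_ball_0 zero_power2)
  have f0: "f 0 = 0" using f by (simp add: class_S_star_def class_A_def)
  have feq: "f u = u * (g u)\<^sup>2" if "u \<in> ball 0 1" for u
    using g that f0 by (simp add: is_sqrt_quot_z_def quot_z_def)
  show "Re (z * deriv g z / g z) > - 1 / 2"
  \<comment> \<open>At 0, where the starlikeness condition is silent, the claim reads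
    \<open>0 > - 1 / 2\<close>.\<close>
  proof (cases "z = 0")
    case False
    have "(g has_field_derivative deriv g z) (at z)"
      using g z by (intro holomorphic_derivI[of g "ball 0 1"]) (auto simp: is_sqrt_quot_z_def)
    hence "((\<lambda>u. u * (g u)\<^sup>2) has_field_derivative (g z)\<^sup>2 + 2 * z * g z * deriv g z) (at z)"
      by (auto intro!: derivative_eq_intros simp: algebra_simps)
    hence "(f has_field_derivative (g z)\<^sup>2 + 2 * z * g z * deriv g z) (at z)"
      by (rule has_field_derivative_transform_within_open[of _ _ _ "ball 0 1"]) (use z feq in auto)
    hence "deriv f z = (g z)\<^sup>2 + 2 * z * g z * deriv g z" by (rule DERIV_imp_deriv)
    hence "z * deriv f z / f z = 1 + 2 * (z * deriv g z / g z)"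
      using gz False z by (simp add: feq field_simps power2_eq_square)
    moreover have "Re (z * deriv f z / f z) > 0"
      using f z False by (simp add: class_S_star_def)
    moreover have "Re (1 + 2 * u) = 1 + 2 * Re u" for u by simp
    ultimately show ?thesis by (smt (verit) divide_minus_left field_sum_of_halves)
  qed simp
qed

text \<open>The second coefficient of \<open>f\<close> is the linear coefficient of
  \<open>g^2\<close>, namely \<open>2 * g 0 * deriv g 0\<close>, and \<open>g 0 = 1\<close>.\<close>

lemma taylor_coeff_2_sqrt:
  assumes f: "f \<in> class_A" and g: "is_sqrt_quot_z f g"
  shows "taylor_coeff f 2 = 2 * deriv g 0"
proof -
  have f0: "f 0 = 0" using f by (simp add: class_A_def)
  define G where "G = fps_expansion g 0"
  have "g analytic_on {0}"
    using g by (auto simp: is_sqrt_quot_z_def analytic_at intro!: exI[of _ "ball 0 1"])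
  hence G: "g has_fps_expansion G"
    unfolding G_def by (rule analytic_at_imp_has_fps_expansion_0)
  hence "(\<lambda>z. z * (g z)\<^sup>2) has_fps_expansion fps_X * G\<^sup>2"
    by (intro fps_expansion_intros)
  moreover have ev: "eventually (\<lambda>z. z * (g z)\<^sup>2 = f z) (nhds 0)"
  proof (rule eventually_mono)
    show "eventually (\<lambda>z. z \<in> ball 0 1) (nhds (0::complex))"
      by (rule eventually_nhds_in_open) auto
  qed (use g f0 in \<open>auto simp: is_sqrt_quot_z_def quot_z_def\<close>)
  ultimately have "f has_fps_expansion fps_X * G\<^sup>2"
    using has_fps_expansion_cong[OF ev refl] by blast
  hence "taylor_coeff f 2 = fps_nth (fps_X * G\<^sup>2) 2"
    by (simp add: taylor_coeff_def fps_expansion_eqI)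
  also have "\<dots> = 2 * fps_nth G 0 * fps_nth G 1"
    by (simp add: power2_eq_square fps_mult_nth numeral_2_eq_2)
  finally show ?thesis
    using g by (simp add: fps_nth_fps_expansion[OF G] is_sqrt_quot_z_def)
qed

text \<open>This is the classical bound 2 on the second coefficient of a starlike function. The map
  \<open>p / (1 + p)\<close> sends the half-plane \<open>Re p > - 1 / 2\<close> into the disc, and
  the Schwarz lemma bounds its derivative at 0.\<close>

lemma starlike_deriv_sqrt_le_1:
  assumes f: "f \<in> class_S_star" and g: "is_sqrt_quot_z f g"
  shows "cmod (deriv g 0) \<le> 1"
proof -
  have holg: "g holomorphic_on ball 0 1" and g0: "g 0 = 1"
    using g by (simp_all add: is_sqrt_quot_z_def)
  define p where "p = (\<lambda>z. z * deriv g z / g z)"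
  define w where "w = (\<lambda>z. p z / (1 + p z))"
  have gz: "g z \<noteq> 0" and p: "Re (p z) > - 1 / 2" if "cmod z < 1" for z
    using starlike_sqrt_log_deriv[OF f g that] by (simp_all add: p_def)
  have nz: "1 + p z \<noteq> 0" if "cmod z < 1" for z
    using p[OF that] by (auto simp: complex_eq_iff)
  have holp: "p holomorphic_on ball 0 1"
    unfolding p_def by (intro holomorphic_intros holg holomorphic_deriv) (use gz in auto)
  have holw: "w holomorphic_on ball 0 1"
    unfolding w_def by (intro holomorphic_intros holp) (use nz in auto)
  have w0: "w 0 = 0" by (simp add: w_def p_def)
  have w1: "cmod (w z) < 1" if z: "cmod z < 1" for z
  proof -
    have "(cmod (1 + p z))\<^sup>2 - (cmod (p z))\<^sup>2 = 1 + 2 * Re (p z)"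
      unfolding cmod_power2 by (simp add: power2_eq_square algebra_simps)
    hence "(cmod (p z))\<^sup>2 < (cmod (1 + p z))\<^sup>2" using p[OF z] by simp
    hence "cmod (p z) < cmod (1 + p z)" by (rule power_less_imp_less_base) simp
    with nz[OF z] show ?thesis by (simp add: w_def norm_divide)
  qed
  \<comment> \<open>The second derivative of \<open>g\<close> enters that of \<open>p\<close> only
    with a factor \<open>z\<close>, so it drops out at 0.\<close>
  have "(deriv g has_field_derivative deriv (deriv g) 0) (at 0)"
       "(g has_field_derivative deriv g 0) (at 0)"
    using holg by (auto intro!: holomorphic_derivI[of _ "ball 0 1"] holomorphic_deriv)
  hence p_deriv: "(p has_field_derivative deriv g 0) (at 0)"
    unfolding p_def by (auto intro!: derivative_eq_intros simp: g0)
  have "p 0 = 0" by (simp add: p_def)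
  hence "(w has_field_derivative deriv g 0) (at 0)"
    unfolding w_def by (auto intro!: derivative_eq_intros p_deriv)
  hence "deriv w 0 = deriv g 0" by (rule DERIV_imp_deriv)
  thus ?thesis using Schwarz_Lemma(2)[OF holw w0 w1, of 0] by simp
qed

section \<open>The constant \<open>\<alpha>\<close> and the first exit from the half-plane\<close>

text \<open>\<open>\<alpha>\<close> is the smaller root of
  \<open>12 * \<alpha>^2 - (20 + a) * \<alpha> + 8 = 0\<close>, which rearranges to the third claim.
  The first claim amounts to \<open>s \<le> 8 + a\<close>, that is, to
  \<open>a \<le> 2\<close>.\<close>

lemma alpha_root:
  fixes a \<alpha> :: real
  assumes a: "0 \<le> a" "a \<le> 2" and \<alpha>: "\<alpha> = (20 + a - sqrt (16 + a\<^sup>2 + 40 * a)) / 24"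
  shows "1 / 2 \<le> \<alpha>" "\<alpha> < 1" "8 * (1 - \<alpha>)\<^sup>2 = \<alpha> * (4 * (1 - \<alpha>) + a)"
proof -
  define s where "s = sqrt (16 + a\<^sup>2 + 40 * a)"
  have s2: "s\<^sup>2 = 16 + a\<^sup>2 + 40 * a" using a by (simp add: s_def)
  have "s \<le> 8 + a"
    unfolding s_def using a by (intro real_le_lsqrt) (auto simp: power2_eq_square algebra_simps)
  thus "1 / 2 \<le> \<alpha>" by (simp add: \<alpha> flip: s_def)
  have "2 < s" unfolding s_def using a by (intro real_less_rsqrt) (auto simp: add_pos_nonneg)
  thus "\<alpha> < 1" using a by (simp add: \<alpha> flip: s_def)
  have "s = 20 + a - 24 * \<alpha>" using \<alpha>[folded s_def] by simp
  with s2 show "8 * (1 - \<alpha>)\<^sup>2 = \<alpha> * (4 * (1 - \<alpha>) + a)"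
    by (simp add: power2_eq_square algebra_simps)
qed

text \<open>A point of least modulus exists because the points of \<open>cball 0 (cmod z1)\<close>
  with \<open>Re g \<le> \<alpha>\<close> form a closed nonempty set. It lies in the closure of a
  disc where \<open>Re g > \<alpha>\<close>, which forces equality.\<close>

lemma closest_half_plane_exit:
  assumes holg: "g holomorphic_on ball 0 1" and g0: "Re (g 0) > \<alpha>"
    and z1: "cmod z1 < 1" "Re (g z1) \<le> \<alpha>"
  obtains z0 where "z0 \<noteq> 0" "cmod z0 < 1" "Re (g z0) = \<alpha>"
    "\<And>z. cmod z < cmod z0 \<Longrightarrow> Re (g z) > \<alpha>"
proof -
  define K where "K = {z \<in> cball 0 (cmod z1). Re (g z) \<le> \<alpha>}"
  have cont: "continuous_on S (\<lambda>z. Re (g z))" if "S \<subseteq> ball 0 1" for S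
    by (intro continuous_intros holomorphic_on_imp_continuous_on holomorphic_on_subset[OF holg] that)
  have "cball 0 (cmod z1) \<subseteq> ball 0 1" using z1 by auto
  hence "closed K"
    unfolding K_def by (intro continuous_on_closed_Collect_le cont) auto
  moreover have "K \<noteq> {}" using z1 by (auto simp: K_def)
  ultimately obtain z0 where z0: "z0 \<in> K" "\<And>y. y \<in> K \<Longrightarrow> dist 0 z0 \<le> dist 0 y"
    using distance_attains_inf[of K 0] by blast
  have z0_lt: "cmod z0 < 1" and "z0 \<noteq> 0" using z0(1) z1 g0 by (auto simp: K_def)
  have gt: "Re (g z) > \<alpha>" if "cmod z < cmod z0" for z
    using z0(1) z0(2)[of z] that by (force simp: K_def)
  have "continuous_on (closure (ball 0 (cmod z0))) (\<lambda>z. Re (g z))"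
    using z0_lt \<open>z0 \<noteq> 0\<close> by (intro cont) auto
  from continuous_ge_on_closure[OF this, of z0 \<alpha>] have "Re (g z0) \<ge> \<alpha>"
    using gt \<open>z0 \<noteq> 0\<close> by force
  with z0(1) have "Re (g z0) = \<alpha>" by (simp add: K_def)
  with that \<open>z0 \<noteq> 0\<close> z0_lt gt show thesis by blast
qed

section \<open>Contradiction at the exit point\<close>

theorem theorem5p3:
  fixes f :: "complex \<Rightarrow> complex" and a2 :: complex and \<alpha> :: real
  assumes "f \<in> class_S_star"
    and "a2 = taylor_coeff f 2"
    and "\<alpha> = (20 + cmod a2 - sqrt (16 + (cmod a2)\<^sup>2 + 40 * cmod a2)) / 24"
  shows "\<forall>z \<in> ball 0 1. Re (sqrt_quot_z f z) > \<alpha>"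
proof (rule ccontr)
  assume "\<not> ?thesis"
  then obtain z1 where z1: "cmod z1 < 1" "Re (sqrt_quot_z f z1) \<le> \<alpha>" by force
  define g where "g = sqrt_quot_z f"
  have g: "is_sqrt_quot_z f g"
    unfolding g_def sqrt_quot_z_def
    by (rule someI_ex[OF is_sqrt_quot_z_exists[OF assms(1)]])
  have holg: "g holomorphic_on ball 0 1" and g0: "g 0 = 1"
    using g by (simp_all add: is_sqrt_quot_z_def)
  define a where "a = cmod a2"
  have a: "a = 2 * cmod (deriv g 0)"
    using taylor_coeff_2_sqrt[OF _ g] assms(1,2) by (simp add: a_def class_S_star_def norm_mult)
  hence "0 \<le> a" "a \<le> 2"
    using starlike_deriv_sqrt_le_1[OF assms(1) g] by auto
  note \<alpha> = alpha_root[OF this assms(3)[folded a_def]]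
  obtain z0 where z0: "z0 \<noteq> 0" "cmod z0 < 1" "Re (g z0) = \<alpha>"
      "\<And>z. cmod z < cmod z0 \<Longrightarrow> Re (g z) > \<alpha>"
    by (rule closest_half_plane_exit[OF holg, of \<alpha> z1]) (use z1 \<alpha> g0 in \<open>auto simp: g_def\<close>)

  \<comment> \<open>Rescaling moves the exit point \<open>z0\<close> to 1, and \<open>q\<close> is
    holomorphic beyond the closed unit disc because \<open>cmod z0 < 1\<close>.\<close>
  define q where "q = (\<lambda>z. g (z0 * z))"
  define R where "R = 1 / cmod z0"
  have R: "R > 1" using z0 by (simp add: R_def)
  have in_ball: "z0 * z \<in> ball 0 1" if "z \<in> ball 0 R" for z
    using that z0 by (simp add: R_def norm_mult field_simps)
  have holq: "q holomorphic_on ball 0 R"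
    unfolding q_def using in_ball
    by (intro holomorphic_on_compose_gen[OF _ holg, unfolded o_def] holomorphic_intros) auto
  have q_deriv: "deriv q z = z0 * deriv g (z0 * z)" if "z \<in> ball 0 R" for z
  proof -
    have "(g has_field_derivative deriv g (z0 * z)) (at (z0 * z))"
      using in_ball[OF that] by (intro holomorphic_derivI[OF holg]) auto
    hence "(q has_field_derivative deriv g (z0 * z) * z0) (at z)"
      unfolding q_def by (rule DERIV_chain2) (auto intro!: derivative_eq_intros)
    thus ?thesis by (simp add: DERIV_imp_deriv mult.commute)
  qed
  have q_gt: "Re (q z) > \<alpha>" if "cmod z < 1" for z
    unfolding q_def by (rule z0(4)) (use that z0 in \<open>simp add: norm_mult\<close>)

  define \<beta> where "\<beta> = 1 - \<alpha>"
  define \<tau> where "\<tau> = Im (q 1)"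
  define D where "D = Re (deriv q 1)"
  define d where "d = cmod (deriv q 0)"
  have \<beta>: "0 < \<beta>" "\<beta> \<le> \<alpha>" using \<alpha> by (simp_all add: \<beta>_def)
  have q1: "q 1 = Complex \<alpha> \<tau>" using z0 by (simp add: complex_eq_iff \<tau>_def q_def)
  have "d = cmod z0 * cmod (deriv g 0)"
    using R by (simp add: d_def q_deriv norm_mult)
  hence d: "0 \<le> d" "2 * d \<le> a"
    using a z0(2) mult_right_mono[of "cmod z0" 1 "cmod (deriv g 0)"] by auto
  have bd: "Im (deriv q 1) = 0" "D \<le> - (\<beta>\<^sup>2 + \<tau>\<^sup>2) / (\<beta> * (1 + d / (2 * \<beta>)))"
    using half_plane_boundary_deriv[OF R holq _ \<alpha>(2) q_gt] z0(3)
    by (simp_all add: q_def g0 D_def \<beta>_def \<tau>_def d_def)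
  have "4 * \<beta> + a > 0" using \<beta> \<open>0 \<le> a\<close> by simp
  moreover have "8 * \<beta>\<^sup>2 = \<alpha> * (4 * \<beta> + a)" using \<alpha>(3) by (simp add: \<beta>_def)
  \<comment> \<open>The quadratic equation for \<open>\<alpha>\<close> is used here. Passing from
    \<open>a\<close> to \<open>2 * d\<close> is safe since the rescaling only shrinks the derivative
    at 0.\<close>
  ultimately have "\<alpha> / (2 * \<beta>\<^sup>2) = 4 / (4 * \<beta> + a)"
    using \<beta> by (subst frac_eq_eq) auto
  also have "\<dots> \<le> 4 / (4 * \<beta> + 2 * d)"
    using \<beta> d by (intro divide_left_mono) (auto intro!: mult_pos_pos add_pos_nonneg)
  also have "\<dots> = 1 / (\<beta> * (1 + d / (2 * \<beta>)))"
  proof -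
    have "4 * \<beta> + 2 * d = 4 * (\<beta> * (1 + d / (2 * \<beta>)))" using \<beta> by (simp add: field_simps)
    thus ?thesis by simp
  qed
  finally have "(\<beta>\<^sup>2 + \<tau>\<^sup>2) * (\<alpha> / (2 * \<beta>\<^sup>2)) \<le> (\<beta>\<^sup>2 + \<tau>\<^sup>2) * (1 / (\<beta> * (1 + d / (2 * \<beta>))))"
    by (rule mult_left_mono) simp
  hence "- (\<beta>\<^sup>2 + \<tau>\<^sup>2) / (\<beta> * (1 + d / (2 * \<beta>))) \<le> - (\<beta>\<^sup>2 + \<tau>\<^sup>2) * \<alpha> / (2 * \<beta>\<^sup>2)"
    unfolding minus_divide_left[symmetric] mult_minus_left by simp
  with bd(2) have "D \<le> - (\<beta>\<^sup>2 + \<tau>\<^sup>2) * \<alpha> / (2 * \<beta>\<^sup>2)" by (rule order_trans)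
  hence "D * (2 * \<beta>\<^sup>2) \<le> - (\<beta>\<^sup>2 + \<tau>\<^sup>2) * \<alpha>"
    using \<beta> by (subst (asm) pos_le_divide_eq) auto
  hence D_le: "2 * D * \<alpha> * \<beta>\<^sup>2 \<le> - (\<beta>\<^sup>2 + \<tau>\<^sup>2) * \<alpha>\<^sup>2"
    using mult_right_mono[of "D * (2 * \<beta>\<^sup>2)" "- (\<beta>\<^sup>2 + \<tau>\<^sup>2) * \<alpha>" \<alpha>] \<alpha>(1)
    by (simp add: mult_ac power2_eq_square)

  have "Re (z0 * deriv g z0 / g z0) > - 1 / 2"
    by (rule starlike_sqrt_log_deriv[OF assms(1) g z0(2)])
  moreover have "z0 * deriv g z0 / g z0 = deriv q 1 / q 1"
    using q_deriv[of 1] R by (simp add: q_def)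
  \<comment> \<open>Since \<open>deriv q 1\<close> is real, only the real part of
    \<open>1 / q 1\<close> matters.\<close>
  moreover have "Re (deriv q 1 / q 1) = D * \<alpha> / (\<alpha>\<^sup>2 + \<tau>\<^sup>2)"
    by (simp add: q1 Re_divide bd(1) D_def)
  ultimately have "- (1 / 2) < D * \<alpha> / (\<alpha>\<^sup>2 + \<tau>\<^sup>2)" by simp
  moreover have "\<alpha>\<^sup>2 + \<tau>\<^sup>2 > 0" using \<alpha>(1) by (intro add_pos_nonneg) auto
  ultimately have "- (\<alpha>\<^sup>2 + \<tau>\<^sup>2) < 2 * D * \<alpha>" by (simp add: field_simps)
  hence "- (\<alpha>\<^sup>2 + \<tau>\<^sup>2) * \<beta>\<^sup>2 < 2 * D * \<alpha> * \<beta>\<^sup>2"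
    using \<beta> by (intro mult_strict_right_mono) auto
  also note D_le
  \<comment> \<open>The terms \<open>\<alpha>^2 * \<beta>^2\<close> cancel between the two bounds on
    \<open>D\<close>; what is left contradicts \<open>\<beta> \<le> \<alpha>\<close>, that is,
    \<open>\<alpha> \<ge> 1 / 2\<close>.\<close>
  finally have "\<alpha>\<^sup>2 * \<tau>\<^sup>2 < \<beta>\<^sup>2 * \<tau>\<^sup>2" by (simp add: algebra_simps)
  moreover have "\<beta>\<^sup>2 * \<tau>\<^sup>2 \<le> \<alpha>\<^sup>2 * \<tau>\<^sup>2"
    using \<beta> by (intro mult_right_mono power_mono) auto
  ultimately show False by simp
qed

end
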